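(* Let $0<s<2m$ with $s\neq m$, let $t$ be a legitimate quadruple, and let $l=0$ or $l\in L^*\setminus(L^* )^{\sigma-1}$. Then $B(2,m,s,l,t)$ is not isotopic to a commutative semifield.
   Context: A (finite) presemifield is a finite additive abelian group with a multiplication that is distributive on both sides over addition and has no zero divisors; it is a semifield if it also has a multiplicative identity, and commutative if its multiplication is commutative. Two presemifields $(F,+,* )$ and $(F,+,\circ)$ are isotopic if there are additive bijections $\alpha_1,\alpha_2,\beta$ with $\beta(\alpha_1(x)*\alpha_2(y))=x\circ y$ for all $x,y$. Let $m\ge 1$, $L=GF(2^m)$, $\sigma=2^s$, $(L^* )^{\sigma-1}=\{u^{\sigma-1}:u\in L^*\}$. A quadruple $t=[p_1,p_2,p_3,p_4]\in L^4$ is legitimate if $p_1\neq0$ and $p_1X^{\sigma+1}+p_2X^{\sigma}+p_3X+p_4$ has no root in $L$. $B(2,m,s,l,t)$ is the presemifield on $L\times L$ with multiplication $$(a,b)\circ(c,d)=(p_1ac^{\sigma}+lp_1a^{\sigma}c+p_2bc^{\sigma}+lp_2a^{\sigma}d+p_3ad^{\sigma}+lp_3b^{\sigma}c+p_4bd^{\sigma}+lp_4b^{\sigma}d,\ ad+bc).$$ *)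

theory Defs
  imports "HOL-Library.Product_Plus" "HOL-Library.Cardinality"
begin

text \<open>
  A finite (pre)semifield is given by its multiplication on a finite type of class
  \<^class>\<open>ab_group_add\<close>, which supplies the additive group. On \<open>L \<times> L\<close> that group is the
  componentwise one of \<^theory>\<open>HOL-Library.Product_Plus\<close>.
\<close>

definition presemifield :: "('f::{finite,ab_group_add} \<Rightarrow> 'f \<Rightarrow> 'f) \<Rightarrow> bool" where
  "presemifield mult \<longleftrightarrow>
     (\<forall>x y z. mult x (y + z) = mult x y + mult x z) \<and>
     (\<forall>x y z. mult (x + y) z = mult x z + mult y z) \<and>
     (\<forall>x y. mult x y = 0 \<longrightarrow> x = 0 \<or> y = 0)"

definition semifield :: "('f::{finite,ab_group_add} \<Rightarrow> 'f \<Rightarrow> 'f) \<Rightarrow> bool" where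
  "semifield mult \<longleftrightarrow> presemifield mult \<and> (\<exists>e. \<forall>x. mult e x = x \<and> mult x e = x)"

definition commutative_semifield :: "('f::{finite,ab_group_add} \<Rightarrow> 'f \<Rightarrow> 'f) \<Rightarrow> bool" where
  "commutative_semifield mult \<longleftrightarrow> semifield mult \<and> (\<forall>x y. mult x y = mult y x)"

definition additive_bij :: "('f::ab_group_add \<Rightarrow> 'g::ab_group_add) \<Rightarrow> bool" where
  "additive_bij f \<longleftrightarrow> bij f \<and> (\<forall>x y. f (x + y) = f x + f y)"

text \<open>
  The two multiplications may live on different additive groups; an isotopism forces these
  groups to be isomorphic.
\<close>

definition isotopic ::
  "('f::{finite,ab_group_add} \<Rightarrow> 'f \<Rightarrow> 'f) \<Rightarrow> ('g::{finite,ab_group_add} \<Rightarrow> 'g \<Rightarrow> 'g) \<Rightarrow> bool"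
where
  "isotopic mult1 mult2 \<longleftrightarrow>
     (\<exists>(\<alpha>1 :: 'g \<Rightarrow> 'f) (\<alpha>2 :: 'g \<Rightarrow> 'f) (\<beta> :: 'f \<Rightarrow> 'g).
        additive_bij \<alpha>1 \<and> additive_bij \<alpha>2 \<and> additive_bij \<beta> \<and>
        (\<forall>x y. \<beta> (mult1 (\<alpha>1 x) (\<alpha>2 y)) = mult2 x y))"

text \<open>
  From here on the field \<open>L = GF(2\<^sup>m)\<close> is a finite field type \<open>'a\<close>, to be used with
  \<open>CARD('a) = 2 ^ m\<close>, and \<open>\<sigma> = 2 ^ s\<close>.
\<close>

type_synonym 'a quadruple = "'a \<times> 'a \<times> 'a \<times> 'a"

fun legitimate :: "nat \<Rightarrow> 'a::{finite,field} quadruple \<Rightarrow> bool" where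
  "legitimate s (p1, p2, p3, p4) \<longleftrightarrow>
     p1 \<noteq> 0 \<and> (\<forall>x. p1 * x ^ (2 ^ s + 1) + p2 * x ^ (2 ^ s) + p3 * x + p4 \<noteq> 0)"

definition unit_powers :: "nat \<Rightarrow> 'a::{finite,field} set" where
  "unit_powers k = {u ^ k | u. u \<noteq> 0}"

text \<open>
  The multiplication of \<open>B(2,m,s,l,t)\<close>; the parameter \<open>m\<close> is determined by the type \<open>'a\<close>.
\<close>

fun B_mult :: "nat \<Rightarrow> 'a::{finite,field} \<Rightarrow> 'a quadruple \<Rightarrow> 'a \<times> 'a \<Rightarrow> 'a \<times> 'a \<Rightarrow> 'a \<times> 'a" where
  "B_mult s l (p1, p2, p3, p4) (a, b) (c, d) =
     (p1 * a * c ^ (2 ^ s) + l * p1 * a ^ (2 ^ s) * c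
      + p2 * b * c ^ (2 ^ s) + l * p2 * a ^ (2 ^ s) * d
      + p3 * a * d ^ (2 ^ s) + l * p3 * b ^ (2 ^ s) * c
      + p4 * b * d ^ (2 ^ s) + l * p4 * b ^ (2 ^ s) * d,
      a * d + b * c)"

end

theory Submission
  imports Defs "HOL-Computational_Algebra.Polynomial"
begin

text \<open>
  If \<open>B\<close> is isotopic to a commutative semifield, there is an additive bijection \<open>\<Phi>\<close> with
  \<open>x \<circ> \<Phi> y = y \<circ> \<Phi> x\<close>. The second component \<open>a d + b c\<close> of the product forces \<open>\<Phi>\<close> to be
  \<open>L\<close>-linear, with matrix \<open>[[k, f], [g, k]]\<close>. Put \<open>P = [[p1, p3], [p2, p4]]\<close>, so that the first
  component of \<open>x \<circ> y\<close> is \<open>x\<^sup>T P y\<^sup>\<sigma> + l y\<^sup>T P x\<^sup>\<sigma>\<close>. As \<open>\<sigma>\<close> is not the identity on \<open>L\<close>, comparing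
  the terms in \<open>x y\<^sup>\<sigma>\<close> gives \<open>P \<Phi>\<^sup>\<sigma> = l \<Phi>\<^sup>T P\<close>. Legitimacy gives \<open>det P \<noteq> 0\<close>, hence
  \<open>(det \<Phi>)\<^sup>\<sigma>\<^sup>-\<^sup>1 = l\<^sup>2\<close>; extracting square roots shows that \<open>l\<close> is a nonzero \<open>(\<sigma>-1)\<close>-th power.
\<close>

text \<open>Multiplication by a nonzero \<open>x\<close> permutes the nonzero elements; comparing
  their product before and after shows that the power of \<open>x\<close> by their number is
  1.\<close>

lemma power_CARD_eq_self:
  fixes x :: "'a::{finite,field}"
  shows "x ^ CARD('a) = x"
proof (cases "x = 0")
  case False
  let ?U = "UNIV - {0} :: 'a set"
  have "bij_betw ((*) x) ?U ?U"
    by (rule bij_betw_byWitness[where f' = "\<lambda>y. y / x"]) (use False in auto)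
  then have "prod id ?U = (\<Prod>y\<in>?U. x * y)"
    using prod.reindex_bij_betw[of "(*) x" ?U ?U id] by simp
  also have "\<dots> = x ^ card ?U * prod id ?U"
    by (simp add: prod.distrib)
  finally have "x ^ card ?U = 1"
    by (simp add: prod_zero_iff)
  moreover have "CARD('a) = Suc (card ?U)"
    by (rule card.remove) simp_all
  ultimately show ?thesis
    by (simp only: power_Suc mult_1_right)
qed (simp add: zero_power)

lemma CHAR_eq_2:
  assumes "CARD('a::{finite,field}) = 2 ^ m" "m \<ge> 1"
  shows "CHAR('a) = 2"
proof -
  have "even CARD('a)"
    using assms by simp
  \<comment> \<open>The power of -1 by the field size is 1 since the exponent is even, and -1 by
    \<open>power_CARD_eq_self\<close>.\<close>
  then have "(1::'a) = - 1"
    using power_CARD_eq_self[of "- 1 :: 'a"] by simp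
  then have "of_nat 2 = (0::'a)"
    by (simp add: eq_neg_iff_add_eq_0)
  then have "CHAR('a) dvd 2"
    using of_nat_eq_0_iff_char_dvd by blast
  then show ?thesis
    by (metis CHAR_not_1' prime_nat_iff two_is_prime_nat One_nat_def)
qed

lemma card_power_fixed_le:
  fixes n :: nat
  assumes "n > 1"
  shows "card {x::'a::idom. x ^ n = x} \<le> n"
proof -
  let ?p = "monom 1 n - monom 1 1 :: 'a poly"
  have "coeff ?p n = 1"
    using assms by simp
  then have "?p \<noteq> 0"
    by (metis coeff_0 zero_neq_one)
  moreover have "degree ?p \<le> n"
    using assms by (intro degree_diff_le) (auto simp: degree_monom_eq)
  ultimately show ?thesis
    using card_poly_roots_bound[of ?p] by (simp add: poly_monom)
qed

lemma frobenius_power_nontrivial: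
  assumes card: "CARD('a::{finite,field}) = 2 ^ m"
    and s: "0 < s" "s < 2 * m" "s \<noteq> m"
  shows "\<exists>x::'a. x ^ 2 ^ s \<noteq> x"
proof (rule ccontr)
  assume "\<nexists>x::'a. x ^ 2 ^ s \<noteq> x"
  then have fixed: "x ^ 2 ^ s = x" for x :: 'a
    by blast
  \<comment> \<open>Since \<open>x ^ 2 ^ m = x\<close>, only \<open>s\<close> modulo
    \<open>m\<close> matters, and the bounds make this residue nonzero. All \<open>2 ^ m\<close>
    elements would then be roots of a polynomial of degree \<open>2 ^ r\<close>.\<close>
  define r where "r = (if s < m then s else s - m)"
  have r: "0 < r" "r < m"
    using s by (auto simp: r_def)
  have "x ^ 2 ^ r = x" for x :: 'a
  proof (cases "s < m")
    case False
    then have "(2::nat) ^ s = CARD('a) * 2 ^ r"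
      by (simp add: card r_def flip: power_add)
    then have "x ^ 2 ^ s = x ^ 2 ^ r"
      by (simp only: power_mult power_CARD_eq_self)
    then show ?thesis
      using fixed by simp
  qed (simp add: r_def fixed)
  then have "CARD('a) \<le> 2 ^ r"
    using card_power_fixed_le[of "2 ^ r", where 'a = 'a] one_less_power[of "2::nat" r] r by simp
  then show False
    using r by (simp add: card)
qed

text \<open>Cancelling the injective \<beta> carries the symmetry of \<open>S\<close> back to
  \<open>M\<close>; the substitution by \<open>inv \<alpha>1\<close> then leaves a twist in one
  argument only.\<close>

lemma commutative_isotope_imp_symmetrizing_bij:
  fixes M :: "'f::{finite,ab_group_add} \<Rightarrow> 'f \<Rightarrow> 'f"
    and S :: "'g::{finite,ab_group_add} \<Rightarrow> 'g \<Rightarrow> 'g"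
  assumes "isotopic M S" and comm: "\<And>x y. S x y = S y x"
  obtains \<Phi> where "bij \<Phi>" "\<And>x y. M x (\<Phi> y) = M y (\<Phi> x)"
proof -
  obtain \<alpha>1 \<alpha>2 :: "'g \<Rightarrow> 'f" and \<beta> :: "'f \<Rightarrow> 'g"
    where bij: "bij \<alpha>1" "bij \<alpha>2" "bij \<beta>" and eq: "\<And>x y. \<beta> (M (\<alpha>1 x) (\<alpha>2 y)) = S x y"
    using assms(1) unfolding isotopic_def additive_bij_def by blast
  have swap: "M (\<alpha>1 x) (\<alpha>2 y) = M (\<alpha>1 y) (\<alpha>2 x)" for x y
    using eq comm bij(3) by (metis bij_is_inj injD)
  show thesis
  proof (rule that[of "\<alpha>2 \<circ> inv \<alpha>1"])
    show "bij (\<alpha>2 \<circ> inv \<alpha>1)"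
      using bij by (simp add: bij_comp bij_imp_bij_inv)
    show "M x ((\<alpha>2 \<circ> inv \<alpha>1) y) = M y ((\<alpha>2 \<circ> inv \<alpha>1) x)" for x y
      using swap[of "inv \<alpha>1 x" "inv \<alpha>1 y"] bij(1) by (simp add: bij_is_surj surj_f_inv_f)
  qed
qed

text \<open>Pairing with the basis vectors reads off both components of \<Phi> as linear forms;
  evaluation at \<open>(0, 1)\<close> shows that the diagonal entries agree.\<close>

lemma symmetric_pairing_imp_linear:
  fixes \<Phi> :: "'a::comm_ring_1 \<times> 'a \<Rightarrow> 'a \<times> 'a"
  assumes "\<And>x y. fst x * snd (\<Phi> y) + snd x * fst (\<Phi> y) = fst y * snd (\<Phi> x) + snd y * fst (\<Phi> x)"
  obtains k f g where "\<And>c d. \<Phi> (c, d) = (k * c + f * d, g * c + k * d)"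
proof -
  have snd: "snd (\<Phi> (c, d)) = c * snd (\<Phi> (1, 0)) + d * fst (\<Phi> (1, 0))" for c d
    using assms[of "(1, 0)" "(c, d)"] by simp
  have fst: "fst (\<Phi> (c, d)) = c * snd (\<Phi> (0, 1)) + d * fst (\<Phi> (0, 1))" for c d
    using assms[of "(0, 1)" "(c, d)"] by simp
  have "snd (\<Phi> (0, 1)) = fst (\<Phi> (1, 0))"
    using snd[of 0 1] by simp
  then have "\<Phi> (c, d) = (fst (\<Phi> (1, 0)) * c + fst (\<Phi> (0, 1)) * d,
      snd (\<Phi> (1, 0)) * c + fst (\<Phi> (1, 0)) * d)" for c d
    using fst[of c d] snd[of c d] by (metis mult.commute prod.collapse)
  then show thesis
    by (rule that)
qed

lemma det_nonzero_of_inj: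
  fixes k f g :: "'a::field"
  assumes "inj \<Phi>" and \<Phi>: "\<And>c d. \<Phi> (c, d) = (k * c + f * d, g * c + k * d)"
  shows "k ^ 2 - f * g \<noteq> 0"
proof
  assume "k ^ 2 - f * g = 0"
  \<comment> \<open>If the determinant vanishes, \<open>(k, - g)\<close> lies in the kernel; should
    this vector be zero, \<open>(1, 0)\<close> does.\<close>
  then have "\<Phi> (k, - g) = \<Phi> (0, 0)"
    by (simp add: \<Phi> power2_eq_square algebra_simps)
  then have "k = 0" "g = 0"
    using \<open>inj \<Phi>\<close> by (simp_all add: inj_eq)
  then have "\<Phi> (1, 0) = \<Phi> (0, 0)"
    by (simp add: \<Phi>)
  then show False
    using \<open>inj \<Phi>\<close> by (simp add: inj_eq)
qed

lemma legitimate_det_nonzero: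
  assumes "legitimate s (p1, p2, p3, p4)"
  shows "p1 * p4 - p2 * p3 \<noteq> 0"
proof
  assume "p1 * p4 - p2 * p3 = 0"
  define x where "x = - p2 / p1"
  have p1: "p1 \<noteq> 0" and no_root: "p1 * x ^ (2 ^ s + 1) + p2 * x ^ 2 ^ s + p3 * x + p4 \<noteq> 0"
    using assms by auto
  \<comment> \<open>As \<open>det P = 0\<close>, the polynomial is \<open>(p1 X + p2) (p1 X\<^sup>\<sigma> + p3) / p1\<close>.\<close>
  have "p1 * (p1 * x ^ (2 ^ s + 1) + p2 * x ^ 2 ^ s + p3 * x + p4)
      = (p1 * x + p2) * (p1 * x ^ 2 ^ s + p3) + (p1 * p4 - p2 * p3)"
    by (simp add: algebra_simps)
  also have "\<dots> = 0"
    using \<open>p1 * p4 - p2 * p3 = 0\<close> p1 by (simp add: x_def)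
  finally show False
    using p1 no_root by simp
qed

text \<open>Taking \<open>a = b = 1\<close> gives \<open>A = B\<close>; then \<open>a = 1\<close>
  and \<open>b = x\<close> give \<open>A * (x ^ n - x) = 0\<close>.\<close>

lemma power_twist_coeff_zero:
  fixes A B x :: "'a::idom"
  assumes "\<And>a b. A * (a * b ^ n) = B * (b * a ^ n)" and "x ^ n \<noteq> x"
  shows "A = 0"
proof -
  have "A = B"
    using assms(1)[of 1 1] by simp
  then show ?thesis
    using assms(1)[of 1 x] assms(2) by simp
qed

lemma B_mult_symmetric_imp_matrix_eq:
  fixes l x :: "'a::{finite,field}"
  assumes sym: "\<And>x y. B_mult s l (p1, p2, p3, p4) x (\<Phi> y) = B_mult s l (p1, p2, p3, p4) y (\<Phi> x)"
    and \<Phi>: "\<And>c d. \<Phi> (c, d) = (k * c + f * d, g * c + k * d)"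
    and x: "x ^ 2 ^ s \<noteq> x"
  shows "p1 * k ^ 2 ^ s + p3 * g ^ 2 ^ s = l * (k * p1 + g * p2)" (is ?c11)
    and "p1 * f ^ 2 ^ s + p3 * k ^ 2 ^ s = l * (k * p3 + g * p4)" (is ?c12)
    and "p2 * k ^ 2 ^ s + p4 * g ^ 2 ^ s = l * (f * p1 + k * p2)" (is ?c21)
    and "p2 * f ^ 2 ^ s + p4 * k ^ 2 ^ s = l * (f * p3 + k * p4)" (is ?c22)
proof -
  note simps = \<Phi> power_mult_distrib algebra_simps zero_power
  \<comment> \<open>These are the entries of
    \<open>P \<Phi>\<^sup>\<sigma> - l \<Phi>\<^sup>T P\<close>. Vectors with one zero coordinate
    isolate them.\<close>
  define M11 where "M11 = p1 * k ^ 2 ^ s + p3 * g ^ 2 ^ s - l * (k * p1 + g * p2)"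
  define M12 where "M12 = p1 * f ^ 2 ^ s + p3 * k ^ 2 ^ s - l * (k * p3 + g * p4)"
  define M21 where "M21 = p2 * k ^ 2 ^ s + p4 * g ^ 2 ^ s - l * (f * p1 + k * p2)"
  define M22 where "M22 = p2 * f ^ 2 ^ s + p4 * k ^ 2 ^ s - l * (f * p3 + k * p4)"
  have "M11 = 0"
  proof (rule power_twist_coeff_zero[OF _ x])
    show "M11 * (a * b ^ 2 ^ s) = M11 * (b * a ^ 2 ^ s)" for a b
      using sym[of "(a, 0)" "(b, 0)"] by (simp add: M11_def simps)
  qed
  then show ?c11
    by (simp add: M11_def)
  have "M12 = 0"
  proof (rule power_twist_coeff_zero[OF _ x])
    show "M12 * (a * b ^ 2 ^ s) = M21 * (b * a ^ 2 ^ s)" for a b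
      using sym[of "(a, 0)" "(0, b)"] by (simp add: M12_def M21_def simps)
  qed
  then show ?c12
    by (simp add: M12_def)
  have "M21 = 0"
  proof (rule power_twist_coeff_zero[OF _ x])
    show "M21 * (a * b ^ 2 ^ s) = M12 * (b * a ^ 2 ^ s)" for a b
      using sym[of "(0, a)" "(b, 0)"] by (simp add: M12_def M21_def simps)
  qed
  then show ?c21
    by (simp add: M21_def)
  have "M22 = 0"
  proof (rule power_twist_coeff_zero[OF _ x])
    show "M22 * (a * b ^ 2 ^ s) = M22 * (b * a ^ 2 ^ s)" for a b
      using sym[of "(0, a)" "(0, b)"] by (simp add: M22_def simps)
  qed
  then show ?c22
    by (simp add: M22_def)
qed

text \<open>This is the freshman's dream for the sum of \<open>x - y\<close> and
  \<open>y\<close>.\<close>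

lemma frobenius_diff:
  fixes x y :: "'a::comm_ring_1"
  assumes "CHAR('a) = 2"
  shows "(x - y) ^ 2 ^ n = x ^ 2 ^ n - y ^ 2 ^ n"
  using freshmans_dream'[of "2 ^ n" n "x - y" y] assms by (simp add: algebra_simps)

lemma root_in_unit_powers:
  fixes l D :: "'a::{finite,field}"
  assumes "CARD('a) = 2 ^ m" "m \<ge> 1" and "D \<noteq> 0" and D: "D ^ 2 ^ s = l ^ 2 * D"
  shows "l \<in> unit_powers (2 ^ s - 1)"
proof -
  \<comment> \<open>This is the square root of \<open>D\<close>, because its square is
    \<open>D ^ 2 ^ m = D\<close>.\<close>
  define u where "u = D ^ 2 ^ (m - 1)"
  have "u ^ 2 = D ^ CARD('a)"
    using assms(1,2) by (simp add: u_def flip: power_mult power_Suc2)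
  then have u: "u ^ 2 = D"
    by (simp add: power_CARD_eq_self)
  have "D * D ^ (2 ^ s - 1) = D * l ^ 2"
    using D by (simp add: mult.commute flip: power_Suc)
  then have "(u ^ (2 ^ s - 1)) ^ 2 = l ^ 2"
    using \<open>D \<noteq> 0\<close> by (simp add: u[symmetric] mult.commute flip: power_mult)
  \<comment> \<open>Squaring is additive in characteristic 2, so equal squares have equal
    roots.\<close>
  then have "(u ^ (2 ^ s - 1) - l) ^ 2 = 0"
    using frobenius_diff[of _ l 1, OF CHAR_eq_2] assms(1,2) by simp
  then show ?thesis
    using u \<open>D \<noteq> 0\<close> by (auto simp: unit_powers_def intro!: exI[of _ u])
qed

theorem theorem7:
  fixes m s :: nat and l :: "'a::{finite,field}" and t :: "'a quadruple"
  assumes "m \<ge> 1"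
    and "CARD('a) = 2 ^ m"
    and "0 < s" and "s < 2 * m" and "s \<noteq> m"
    and "legitimate s t"
    and "l = 0 \<or> (l \<noteq> 0 \<and> l \<notin> unit_powers (2 ^ s - 1))"
  shows "\<not> (\<exists>S :: 'b::{finite,ab_group_add} \<Rightarrow> 'b \<Rightarrow> 'b.
              commutative_semifield S \<and> isotopic (B_mult s l t) S)"
proof
  assume "\<exists>S :: 'b \<Rightarrow> 'b \<Rightarrow> 'b. commutative_semifield S \<and> isotopic (B_mult s l t) S"
  then obtain \<Phi> where "bij \<Phi>" and sym: "\<And>x y. B_mult s l t x (\<Phi> y) = B_mult s l t y (\<Phi> x)"
    by (metis commutative_isotope_imp_symmetrizing_bij commutative_semifield_def)
  obtain p1 p2 p3 p4 where t: "t = (p1, p2, p3, p4)"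
    by (cases t)
  have "snd (B_mult s l t x y) = fst x * snd y + snd x * fst y" for x y
    by (cases x; cases y) (simp add: t)
  with sym obtain k f g where \<Phi>: "\<And>c d. \<Phi> (c, d) = (k * c + f * d, g * c + k * d)"
    by (metis symmetric_pairing_imp_linear)
  define D where "D = k ^ 2 - f * g"
  have "D \<noteq> 0"
    using det_nonzero_of_inj[OF bij_is_inj \<Phi>] \<open>bij \<Phi>\<close> by (simp add: D_def)
  obtain x :: 'a where "x ^ 2 ^ s \<noteq> x"
    using frobenius_power_nontrivial assms(2-5) by blast
  note entries = B_mult_symmetric_imp_matrix_eq[OF sym[unfolded t] \<Phi> this]
  have D_twist: "D ^ 2 ^ s = (k ^ 2 ^ s) ^ 2 - f ^ 2 ^ s * g ^ 2 ^ s"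
    using frobenius_diff[OF CHAR_eq_2[OF assms(2,1)]]
    by (simp add: D_def power_mult_distrib power_commutes mult.commute flip: power_mult)
  \<comment> \<open>Determinants are taken on both sides of the matrix equation; the factor
    \<open>l\<close> on a 2 by 2 matrix contributes \<open>l ^ 2\<close>.\<close>
  have "(p1 * p4 - p2 * p3) * D ^ 2 ^ s =
      (p1 * k ^ 2 ^ s + p3 * g ^ 2 ^ s) * (p2 * f ^ 2 ^ s + p4 * k ^ 2 ^ s)
    - (p1 * f ^ 2 ^ s + p3 * k ^ 2 ^ s) * (p2 * k ^ 2 ^ s + p4 * g ^ 2 ^ s)"
    by (simp add: D_twist power2_eq_square algebra_simps)
  also have "\<dots> = (p1 * p4 - p2 * p3) * (l ^ 2 * D)"
    unfolding entries D_def by (simp add: power2_eq_square algebra_simps)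
  finally have D_power: "D ^ 2 ^ s = l ^ 2 * D"
    using legitimate_det_nonzero[OF assms(6)[unfolded t]] by simp
  then have "l \<noteq> 0"
    using \<open>D \<noteq> 0\<close> by auto
  moreover have "l \<in> unit_powers (2 ^ s - 1)"
    using assms(1,2) \<open>D \<noteq> 0\<close> D_power by (intro root_in_unit_powers)
  ultimately show False
    using assms(7) by blast
qed

end
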